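(* Let $d\ge 1$, $\mathbf{q}\in\mathbb{R}^d$, let $E,G\in\mathbb{R}^{d\times d}$ be invertible matrices, and let $t\in(0,1)$. Consider the anisotropic Gaussian $\phi_{\mathbf{q}}(\mathbf{x})=\exp(-(\mathbf{x}-\mathbf{q})^TE^TE(\mathbf{x}-\mathbf{q}))$, $\mathbf{x}\in\mathbb{R}^d$. Then for any shift $\mathbf{x}_0\in\mathbb{R}^d$ the following relation holds pointwise in $\mathbf{x}\in\mathbb{R}^d$: $$\phi_{\mathbf{q}}(\mathbf{x})=\exp\left(\boldsymbol{\Delta}_{\mathbf{q}}^T(\tilde G-E^TE)\boldsymbol{\Delta}_{\mathbf{q}}\right)\cdot\sum_{\boldsymbol{\ell}\in\mathbb{N}^d}\frac{(G^{-1}E^TE\boldsymbol{\Delta}_{\mathbf{q}})^{\boldsymbol{\ell}}\sqrt{2^{|\boldsymbol{\ell}|}}}{\sqrt{t^{|\boldsymbol{\ell}|}\,\boldsymbol{\ell}!}}\,H_{\boldsymbol{\ell}}^{G,E,t}(\mathbf{x}-\mathbf{x}_0),$$ where $\boldsymbol{\Delta}_{\mathbf{q}}=\mathbf{q}-\mathbf{x}_0$ and $\tilde G=E^TE\,G^{-T}G^{-1}E^TE$.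
   Context: Here $\mathbb{N}=\{0,1,2,\dots\}$. For a multi-index $\boldsymbol{\ell}=(\ell_1,\dots,\ell_d)\in\mathbb{N}^d$ and $\mathbf{y}\in\mathbb{R}^d$: $|\boldsymbol{\ell}|=\ell_1+\dots+\ell_d$, $\boldsymbol{\ell}!=\ell_1!\cdots\ell_d!$, $\mathbf{y}^{\boldsymbol{\ell}}=y_1^{\ell_1}\cdots y_d^{\ell_d}$ (with $0^0=1$). The physicists' Hermite polynomials are given by $h_{\ell+1}(x)=2x\,h_\ell(x)-2\ell\,h_{\ell-1}(x)$, $h_0(x)=1$, $h_{-1}(x)=0$, and their tensor products are $h_{\boldsymbol{\ell}}(\mathbf{x})=h_{\ell_1}(x_1)\cdots h_{\ell_d}(x_d)$. The multivariate HermiteGF functions are $$H_{\boldsymbol{\ell}}^{G,E,t}(\mathbf{x})=\frac{t^{|\boldsymbol{\ell}|/2}}{\sqrt{2^{|\boldsymbol{\ell}|}\,\boldsymbol{\ell}!}}\,h_{\boldsymbol{\ell}}(G^T\mathbf{x})\exp(-\mathbf{x}^TE^TE\mathbf{x}).$$ *)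

theory Defs
  imports "HOL-Analysis.Analysis"
begin

text \<open>
  Points of \<open>\<real>\<^sup>d\<close> are vectors of type \<open>real ^ 'n\<close> and multi-indices are functions
  \<open>'n \<Rightarrow> nat\<close>, with \<open>d = CARD('n)\<close>.
\<close>

definition mi_abs :: "('n::finite \<Rightarrow> nat) \<Rightarrow> nat" where
  "mi_abs l = (\<Sum>i\<in>UNIV. l i)"

definition mi_fact :: "('n::finite \<Rightarrow> nat) \<Rightarrow> nat" where
  "mi_fact l = (\<Prod>i\<in>UNIV. fact (l i))"

definition mi_power :: "real ^ 'n \<Rightarrow> ('n::finite \<Rightarrow> nat) \<Rightarrow> real" where
  "mi_power y l = (\<Prod>i\<in>UNIV. (y $ i) ^ l i)"

text \<open>
  Physicists' Hermite polynomials. The second equation is the instance \<open>l = 0\<close> of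
  \<open>h\<^bsub>l+1\<^esub>(x) = 2 x h\<^bsub>l\<^esub>(x) - 2 l h\<^bsub>l-1\<^esub>(x)\<close> with the convention \<open>h\<^bsub>-1\<^esub> = 0\<close>.
\<close>

fun hermite :: "nat \<Rightarrow> real \<Rightarrow> real" where
  "hermite 0 x = 1"
| "hermite (Suc 0) x = 2 * x * hermite 0 x"
| "hermite (Suc (Suc l)) x = 2 * x * hermite (Suc l) x - 2 * real (Suc l) * hermite l x"

definition hermite_tensor :: "('n::finite \<Rightarrow> nat) \<Rightarrow> real ^ 'n \<Rightarrow> real" where
  "hermite_tensor l x = (\<Prod>i\<in>UNIV. hermite (l i) (x $ i))"

definition hermiteGF ::
  "('n::finite \<Rightarrow> nat) \<Rightarrow> real ^ 'n ^ 'n \<Rightarrow> real ^ 'n ^ 'n \<Rightarrow> real \<Rightarrow> real ^ 'n \<Rightarrow> real" where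
  "hermiteGF l G E t x =
     t powr (real (mi_abs l) / 2) / sqrt (2 ^ mi_abs l * real (mi_fact l))
     * hermite_tensor l (transpose G *v x)
     * exp (- (x \<bullet> ((transpose E ** E) *v x)))"

definition aniso_gaussian :: "real ^ 'n ^ 'n \<Rightarrow> real ^ 'n \<Rightarrow> real ^ 'n \<Rightarrow> real" where
  "aniso_gaussian E q x = exp (- ((x - q) \<bullet> ((transpose E ** E) *v (x - q))))"

definition G_tilde :: "real ^ 'n ^ 'n \<Rightarrow> real ^ 'n ^ 'n \<Rightarrow> real ^ 'n ^ 'n" where
  "G_tilde G E =
     transpose E ** E ** transpose (matrix_inv G) ** matrix_inv G ** transpose E ** E"

end

theory Submission
  imports Defs
begin

text \<open>
  In \<open>d\<close> variables the summand does not depend on \<open>t\<close>: the normalising factors of \<open>H\<^sub>l\<close> cancel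
  against those of the coefficients and, with \<open>y = G\<inverse>E\<^sup>TE\<Delta>\<close> and \<open>z = x - x\<^sub>0\<close>, what is left is
  \<open>(y\<^sup>l / l!) h\<^sub>l(G\<^sup>Tz) exp(-z\<^sup>TE\<^sup>TEz)\<close>. Up to the last factor this is a product over the coordinates
  of terms of the Hermite generating function
  \<open>exp(2uy - y\<^sup>2) = (\<Sum>n. h\<^sub>n(u) / n! y\<^sup>n)\<close>, which converges absolutely for all real \<open>u\<close> and \<open>y\<close>. Hence
  the sum over all multi-indices converges to \<open>exp(2y\<^sup>TG\<^sup>Tz - y\<^sup>Ty - z\<^sup>TE\<^sup>TEz)\<close>. Here \<open>G\<close> drops out of
  \<open>y\<^sup>TG\<^sup>Tz = \<Delta>\<^sup>TE\<^sup>TEz\<close>, whereas \<open>y\<^sup>Ty\<close> is the value at \<open>\<Delta>\<close> of the quadratic form of \<open>G_tilde G E\<close>. The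
  prefactor of the theorem cancels the latter and completes the square to
  \<open>-(z - \<Delta>)\<^sup>TE\<^sup>TE(z - \<Delta>)\<close>, and \<open>z - \<Delta> = x - q\<close>.

  The generating function itself is obtained from formal power series: \<open>exp(2uX)\<close> times \<open>exp(-X\<^sup>2)\<close>
  satisfies the differential equation \<open>F' = (2u - 2X) F\<close>, which is the Hermite recurrence for the
  coefficients; the analytic identity then follows from the Cauchy product of the two
  absolutely convergent exponential series.
\<close>

section \<open>The generating function of the Hermite polynomials\<close>

text \<open>The formal power series \<open>exp(-X\<^sup>2)\<close>.\<close>

definition fps_gaussian :: "real fps" where
  "fps_gaussian = Abs_fps (\<lambda>n. if even n then (-1) ^ (n div 2) / fact (n div 2) else 0)"

lemma fps_deriv_gaussian: "fps_deriv fps_gaussian = - (2 * fps_X * fps_gaussian)"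
proof (rule fps_ext)
  fix n
  show "fps_nth (fps_deriv fps_gaussian) n = fps_nth (- (2 * fps_X * fps_gaussian)) n"
  proof (cases n)
    case 0
    then show ?thesis by (simp add: fps_gaussian_def mult.assoc numeral_fps_const)
  next
    case (Suc m)
    show ?thesis
    proof (cases "even m")
      case True
      then obtain k where "m = 2 * k" by (elim evenE)
      moreover have "fact k + fact k * real k > 0"
        by (simp add: add_pos_nonneg)
      ultimately show ?thesis
        using Suc by (simp add: fps_gaussian_def mult.assoc numeral_fps_const field_simps)
    next
      case False
      with Suc show ?thesis
        by (simp add: fps_gaussian_def mult.assoc numeral_fps_const)
    qed
  qed
qed

text \<open>
  Comparing coefficients in \<open>F' = (2u - 2X) F\<close> gives \<open>(n + 2) F\<^sub>n\<^sub>+\<^sub>2 = 2u F\<^sub>n\<^sub>+\<^sub>1 - 2 F\<^sub>n\<close>, which is the Hermite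
  recurrence divided by \<open>(n + 1)!\<close>.
\<close>

lemma fps_nth_hermite_generating:
  "fps_nth (fps_exp (2 * u) * fps_gaussian) n = hermite n u / fact n"
proof -
  define F where "F = fps_exp (2 * u) * fps_gaussian"
  have F0: "fps_nth F 0 = 1"
    by (simp add: F_def fps_gaussian_def)
  have deriv: "fps_deriv F = fps_const (2 * u) * F - fps_const 2 * (fps_X * F)"
    by (simp add: F_def fps_deriv_gaussian numeral_fps_const algebra_simps)
  have rec: "real (Suc m) * fps_nth F (Suc m)
      = 2 * u * fps_nth F m - (if m = 0 then 0 else 2 * fps_nth F (m - 1))"
    for m
    using arg_cong[OF deriv, of "\<lambda>f. fps_nth f m"] by simp
  have "fps_nth F n = hermite n u / fact n"
  proof (induction n rule: induct_nat_012)
    case 0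
    show ?case by (simp add: F0)
  next
    case 1
    show ?case using rec[of 0] by (simp add: F0)
  next
    case (ge2 k)
    have "real (Suc (Suc k)) * fps_nth F (Suc (Suc k))
        = 2 * u * (hermite (Suc k) u / fact (Suc k)) - 2 * (hermite k u / fact k)"
      using rec[of "Suc k"] ge2.IH by simp
    also have "hermite k u / fact k = real (Suc k) * hermite k u / fact (Suc k)"
      by (simp del: of_nat_Suc)
    also have "2 * u * (hermite (Suc k) u / fact (Suc k)) - 2 * \<dots>
        = hermite (Suc (Suc k)) u / fact (Suc k)"
      by (simp add: diff_divide_distrib del: of_nat_Suc fact_Suc)
    also have "\<dots> = real (Suc (Suc k)) * (hermite (Suc (Suc k)) u / fact (Suc (Suc k)))"
      by (simp only: fact_Suc[of "Suc k"] of_nat_mult) (simp del: of_nat_Suc)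
    finally show ?case by (simp only: mult_cancel_left of_nat_eq_0_iff) simp
  qed
  then show ?thesis by (simp add: F_def)
qed

text \<open>Dropping the vanishing odd coefficients leaves the exponential series at \<open>-y\<^sup>2\<close>.\<close>

lemma gaussian_series:
  fixes y :: real
  shows "(\<lambda>n. fps_nth fps_gaussian n * y ^ n) sums exp (- (y\<^sup>2))"
    and "summable (\<lambda>n. norm (fps_nth fps_gaussian n * y ^ n))"
proof -
  have mono: "strict_mono (\<lambda>n::nat. 2 * n)"
    by (simp add: strict_mono_def)
  have odd: "fps_nth fps_gaussian n * y ^ n = 0" if "n \<notin> range (\<lambda>n. 2 * n)" for n
  proof -
    have "odd n" using that by (auto elim: evenE)
    then show ?thesis by (simp add: fps_gaussian_def)
  qed
  have even: "fps_nth fps_gaussian (2 * n) * y ^ (2 * n) = (- (y\<^sup>2)) ^ n /\<^sub>R fact n" for n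
    by (simp add: fps_gaussian_def power_mult divide_inverse power_minus[of "y\<^sup>2"])
  have "(\<lambda>n. fps_nth fps_gaussian (2 * n) * y ^ (2 * n)) sums exp (- (y\<^sup>2))"
    unfolding even by (rule exp_converges)
  then show "(\<lambda>n. fps_nth fps_gaussian n * y ^ n) sums exp (- (y\<^sup>2))"
    by (subst (asm) sums_mono_reindex[OF mono odd])
  have "summable (\<lambda>n. norm (fps_nth fps_gaussian (2 * n) * y ^ (2 * n)))"
    unfolding even by (rule summable_norm_exp)
  then show "summable (\<lambda>n. norm (fps_nth fps_gaussian n * y ^ n))"
    by (subst (asm) summable_mono_reindex[OF mono]) (metis norm_zero odd)+
qed

lemma hermite_generating_sums:
  "(\<lambda>n. hermite n u / fact n * y ^ n) sums exp (2 * u * y - y\<^sup>2)"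
proof -
  let ?a = "\<lambda>n. fps_nth (fps_exp (2 * u)) n * y ^ n"
  have a: "?a = (\<lambda>n. (2 * u * y) ^ n /\<^sub>R fact n)"
    by (simp add: fun_eq_iff power_mult_distrib divide_inverse mult_ac)
  have "(\<Sum>i\<le>n. ?a i * (fps_nth fps_gaussian (n - i) * y ^ (n - i))) = hermite n u / fact n * y ^ n" for n
  proof -
    have "(\<Sum>i\<le>n. ?a i * (fps_nth fps_gaussian (n - i) * y ^ (n - i)))
        = (\<Sum>i\<le>n. fps_nth (fps_exp (2 * u)) i * fps_nth fps_gaussian (n - i) * y ^ n)"
    proof (rule sum.cong[OF refl])
      fix i assume "i \<in> {..n}"
      then have "y ^ n = y ^ i * y ^ (n - i)" by (simp flip: power_add)
      then show "?a i * (fps_nth fps_gaussian (n - i) * y ^ (n - i))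
          = fps_nth (fps_exp (2 * u)) i * fps_nth fps_gaussian (n - i) * y ^ n" by (simp only: mult_ac)
    qed
    also have "\<dots> = fps_nth (fps_exp (2 * u) * fps_gaussian) n * y ^ n"
      by (simp only: fps_mult_nth atLeast0AtMost sum_distrib_right)
    finally show ?thesis by (simp only: fps_nth_hermite_generating)
  qed
  moreover have "(\<lambda>n. \<Sum>i\<le>n. ?a i * (fps_nth fps_gaussian (n - i) * y ^ (n - i)))
      sums ((\<Sum>n. ?a n) * (\<Sum>n. fps_nth fps_gaussian n * y ^ n))"
    by (intro Cauchy_product_sums gaussian_series(2)) (use summable_norm_exp[of "2 * u * y"] in \<open>simp only: a[unfolded fun_eq_iff, rule_format]\<close>)
  moreover have "(\<Sum>n. ?a n) = exp (2 * u * y)"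
    by (simp only: a exp_def)
  moreover have "(\<Sum>n. fps_nth fps_gaussian n * y ^ n) = exp (- (y\<^sup>2))"
    using gaussian_series(1) by (rule sums_unique[symmetric])
  ultimately show ?thesis by (simp flip: exp_add)
qed

text \<open>
  A power series that converges everywhere converges absolutely everywhere; the point
  \<open>\<bar>y\<bar> + 1\<close> is any one of larger modulus than \<open>y\<close>.
\<close>

lemma hermite_generating_summable_norm:
  "summable (\<lambda>n. norm (hermite n u / fact n * y ^ n))"
proof (rule powser_insidea)
  show "summable (\<lambda>n. hermite n u / fact n * (\<bar>y\<bar> + 1) ^ n)"
    by (rule sums_summable[OF hermite_generating_sums])
  show "norm y < norm (\<bar>y\<bar> + 1)" by simp
qed

lemma hermite_generating_has_sum:
  "((\<lambda>n. hermite n u / fact n * y ^ n) has_sum exp (2 * u * y - y\<^sup>2)) UNIV"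
  by (rule norm_summable_imp_has_sum[OF hermite_generating_summable_norm hermite_generating_sums])

section \<open>Products over the coordinates\<close>

text \<open>
  This is the distributive law for infinite sums. It needs absolute convergence of each
  factor, which is automatic here: unordered summability of real families is absolute.
\<close>

lemma has_sum_prod_multi_index:
  fixes f :: "'n::finite \<Rightarrow> nat \<Rightarrow> real"
  assumes "\<And>i. (f i has_sum s i) UNIV"
  shows "((\<lambda>l. \<Prod>i\<in>UNIV. f i (l i)) has_sum (\<Prod>i\<in>UNIV. s i)) UNIV"
proof -
  have abs: "(\<lambda>n. norm (f i n)) summable_on UNIV" for i
    using assms summable_on_iff_abs_summable_on_real summable_on_def by blast
  have "Infinite_Set_Sum.abs_summable_on (\<lambda>l. \<Prod>i\<in>UNIV. f i (l i)) (PiE UNIV (\<lambda>_. UNIV))"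
    by (intro abs_summable_on_prod_PiE) (simp_all add: abs[unfolded real_norm_def] flip: abs_summable_equivalent)
  then have "(\<lambda>l. \<Prod>i\<in>UNIV. f i (l i)) summable_on UNIV"
    by (subst summable_on_iff_abs_summable_on_real) (simp add: PiE_UNIV_domain flip: abs_summable_equivalent)
  moreover have "(\<Sum>\<^sub>\<infinity>l\<in>UNIV. \<Prod>i\<in>UNIV. f i (l i)) = (\<Prod>i\<in>UNIV. s i)"
    using infsum_prod_PiE_abs[of UNIV f "\<lambda>_. UNIV"] abs by (simp add: infsumI[OF assms])
  ultimately show ?thesis by (simp add: has_sum_iff)
qed

lemma hermite_tensor_generating_has_sum:
  fixes u y :: "real ^ 'n"
  shows "((\<lambda>l. mi_power y l / real (mi_fact l) * hermite_tensor l u)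
            has_sum exp (2 * (y \<bullet> u) - y \<bullet> y)) UNIV"
proof -
  have "(\<Prod>i\<in>UNIV. exp (2 * (u $ i) * (y $ i) - (y $ i)\<^sup>2)) = exp (2 * (y \<bullet> u) - y \<bullet> y)"
    by (simp add: inner_vec_def sum_subtractf sum_distrib_left power2_eq_square mult_ac flip: exp_sum)
  moreover have "(\<Prod>i\<in>UNIV. hermite (l i) (u $ i) / fact (l i) * (y $ i) ^ l i)
      = mi_power y l / real (mi_fact l) * hermite_tensor l u" for l
    by (simp add: mi_power_def mi_fact_def hermite_tensor_def prod.distrib prod_dividef)
  ultimately show ?thesis
    using has_sum_prod_multi_index[OF hermite_generating_has_sum, of "\<lambda>i. u $ i" "\<lambda>i. y $ i"]
    by simp
qed

section \<open>The expansion of the anisotropic Gaussian\<close>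

text \<open>
  The powers of \<open>2\<close> and \<open>t\<close> cancel and the two factors \<open>sqrt (l!)\<close> multiply to \<open>l!\<close>. This is what
  makes the sum independent of \<open>t\<close>.
\<close>

lemma hermiteGF_term:
  assumes "0 < t"
  shows "mi_power y l * sqrt (2 ^ mi_abs l) / sqrt (t ^ mi_abs l * real (mi_fact l)) * hermiteGF l G E t z
       = mi_power y l / real (mi_fact l) * hermite_tensor l (transpose G *v z)
           * exp (- (z \<bullet> ((transpose E ** E) *v z)))"
proof -
  define n where "n = mi_abs l"
  define m where "m = real (mi_fact l)"
  have m: "m > 0"
    by (auto simp: m_def mi_fact_def intro!: prod_pos)
  have t: "t powr (real n / 2) = sqrt (t ^ n)"
    using assms by (simp add: powr_powr flip: powr_half_sqrt powr_realpow)
  have cancel: "sqrt (2 ^ n) / sqrt (t ^ n * m) * (sqrt (t ^ n) / sqrt (2 ^ n * m)) = 1 / m"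
    using m assms by (simp add: real_sqrt_mult)
  have "p * sqrt (2 ^ n) / sqrt (t ^ n * m) * (sqrt (t ^ n) / sqrt (2 ^ n * m) * h * e)
      = p * (sqrt (2 ^ n) / sqrt (t ^ n * m) * (sqrt (t ^ n) / sqrt (2 ^ n * m))) * h * e" for p h e :: real
    by simp
  then show ?thesis
    unfolding hermiteGF_def n_def[symmetric] m_def[symmetric] t cancel by simp
qed

lemma inner_matrix_vector_transpose:
  fixes A :: "real ^ 'n ^ 'm"
  shows "x \<bullet> (A *v y) = (transpose A *v x) \<bullet> y"
  by (simp add: dot_lmul_matrix)

text \<open>
  Writing \<open>y = G\<inverse>MD\<close>, the mixed term is \<open>y\<^sup>TG\<^sup>Tz = (Gy)\<^sup>Tz = (MD)\<^sup>Tz\<close>, the cross term of the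
  quadratic form of \<open>M\<close>, and \<open>y\<^sup>Ty = D\<^sup>TMG\<^sup>-\<^sup>TG\<inverse>MD\<close> is the quadratic form of \<open>G_tilde G E\<close>, so
  that the two occurrences of the latter cancel. The symmetry of \<open>M = E\<^sup>TE\<close> makes the two cross
  terms of the square equal and lets \<open>M\<close> move across the inner product in \<open>y\<^sup>Ty\<close>.
\<close>

lemma gaussian_exponents:
  fixes E G :: "real ^ 'n ^ 'n" and D z :: "real ^ 'n"
  assumes "invertible G"
  defines "M \<equiv> transpose E ** E"
  defines "y \<equiv> (matrix_inv G ** transpose E ** E) *v D"
  shows "- ((z - D) \<bullet> (M *v (z - D)))
       = D \<bullet> ((G_tilde G E - M) *v D)
         + (2 * (y \<bullet> (transpose G *v z)) - y \<bullet> y - z \<bullet> (M *v z))"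
proof -
  have M_sym: "transpose M = M"
    by (simp add: M_def matrix_transpose_mul)
  have y: "y = matrix_inv G *v (M *v D)"
    by (simp only: y_def M_def matrix_vector_mul_assoc matrix_mul_assoc)
  have "G ** matrix_inv G = mat 1"
    using assms(1) unfolding invertible_def matrix_inv_def by (rule someI2_ex) simp
  then have "G *v y = M *v D"
    by (simp only: y matrix_vector_mul_assoc matrix_mul_assoc matrix_mul_lid)
  then have cross: "y \<bullet> (transpose G *v z) = (M *v D) \<bullet> z"
    by (simp only: inner_matrix_vector_transpose transpose_transpose)
  have "G_tilde G E *v D = M *v (transpose (matrix_inv G) *v y)"
    by (simp only: G_tilde_def y M_def matrix_vector_mul_assoc matrix_mul_assoc)
  then have "D \<bullet> (G_tilde G E *v D) = (matrix_inv G *v (M *v D)) \<bullet> y"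
    by (simp only: inner_matrix_vector_transpose[of _ _ "_ *v y"] inner_matrix_vector_transpose[of _ _ y]
        M_sym transpose_transpose)
  then have sq: "D \<bullet> (G_tilde G E *v D) = y \<bullet> y"
    by (simp only: y)
  have swap: "z \<bullet> (M *v D) = D \<bullet> (M *v z)"
    using inner_matrix_vector_transpose[of z M D] by (simp only: M_sym inner_commute)
  show ?thesis
    unfolding cross
    by (simp add: sq swap inner_commute[of "M *v D" z] matrix_vector_mult_diff_distrib
        matrix_vector_mult_diff_rdistrib inner_diff_left inner_diff_right)
qed

theorem proposition2p2:
  fixes q x0 x :: "real ^ 'n" and E G :: "real ^ 'n ^ 'n" and t :: real
  assumes "invertible E" and "invertible G" and "0 < t" and "t < 1"
  shows "let \<Delta> = q - x0;
             a = (\<lambda>l. mi_power ((matrix_inv G ** transpose E ** E) *v \<Delta>) l * sqrt (2 ^ mi_abs l)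
                      / sqrt (t ^ mi_abs l * real (mi_fact l))
                      * hermiteGF l G E t (x - x0))
         in a summable_on UNIV \<and>
            aniso_gaussian E q x =
              exp (\<Delta> \<bullet> ((G_tilde G E - transpose E ** E) *v \<Delta>)) * (\<Sum>\<^sub>\<infinity>l\<in>UNIV. a l)"
proof -
  define D where "D = q - x0"
  define z where "z = x - x0"
  define M where "M = transpose E ** E"
  define y where "y = (matrix_inv G ** transpose E ** E) *v D"
  define a where "a = (\<lambda>l. mi_power y l * sqrt (2 ^ mi_abs l)
      / sqrt (t ^ mi_abs l * real (mi_fact l)) * hermiteGF l G E t z)"
  have "(a has_sum exp (2 * (y \<bullet> (transpose G *v z)) - y \<bullet> y) * exp (- (z \<bullet> (M *v z)))) UNIV"
    unfolding a_def hermiteGF_term[OF \<open>0 < t\<close>] M_def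
    by (intro has_sum_cmult_left hermite_tensor_generating_has_sum)
  then have sum: "(a has_sum exp (2 * (y \<bullet> (transpose G *v z)) - y \<bullet> y - z \<bullet> (M *v z))) UNIV"
    by (simp only: diff_conv_add_uminus[of _ "z \<bullet> (M *v z)"] exp_add)
  have "x - q = z - D"
    by (simp add: z_def D_def)
  then have "aniso_gaussian E q x = exp (- ((z - D) \<bullet> (M *v (z - D))))"
    by (simp only: aniso_gaussian_def M_def)
  also have "\<dots> = exp (D \<bullet> ((G_tilde G E - M) *v D)) * (\<Sum>\<^sub>\<infinity>l\<in>UNIV. a l)"
    unfolding infsumI[OF sum] exp_add[symmetric]
    by (simp only: gaussian_exponents[OF \<open>invertible G\<close>, of z D E, folded M_def y_def])
  finally have "a summable_on UNIV \<and>
      aniso_gaussian E q x = exp (D \<bullet> ((G_tilde G E - M) *v D)) * (\<Sum>\<^sub>\<infinity>l\<in>UNIV. a l)"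
    using sum by (blast intro: has_sum_imp_summable)
  then show ?thesis
    unfolding Let_def a_def y_def M_def D_def z_def .
qed

end
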